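(* Let $q$ be a complex number with $|q|<1$. Then $$\sum_{n=1}^{\infty}\frac{q^n}{(-q^n;q)_{n+1}(-q^{2n+2};q^2)_{\infty}}=\sum_{j=0}^{\infty}(-1)^jq^{6j^2+4j+1}(1+q^{4j+2}).$$
   Context: Notation: $(a;q)_n:=\prod_{j=0}^{n-1}(1-aq^j)$ for $n\ge 0$ (empty product equal to 1) and $(a;q)_\infty:=\lim_{n\to\infty}(a;q)_n$. *)

theory Defs
  imports "HOL-Analysis.Analysis"
begin

definition qpoch :: "complex \<Rightarrow> complex \<Rightarrow> nat \<Rightarrow> complex" where
  "qpoch a q n = (\<Prod>j<n. 1 - a * q ^ j)"

definition qpoch_inf :: "complex \<Rightarrow> complex \<Rightarrow> complex" where
  "qpoch_inf a q = lim (\<lambda>n. qpoch a q n)"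

text \<open>The limit exists whenever \<open>norm q < 1\<close>, so \<^const>\<open>lim\<close> is not an arbitrary value there.\<close>

lemma qpoch_tendsto_qpoch_inf:
  assumes "norm q < 1"
  shows "(\<lambda>n. qpoch a q n) \<longlonglongrightarrow> qpoch_inf a q"
proof -
  have "summable (\<lambda>j. norm a * norm q ^ j)"
    using assms by (intro summable_mult summable_geometric) auto
  hence "summable (\<lambda>j. norm ((1 - a * q ^ j) - 1))"
    by (simp add: norm_mult norm_power)
  hence "convergent_prod (\<lambda>j. 1 - a * q ^ j)"
    by (intro abs_convergent_prod_imp_convergent_prod summable_imp_abs_convergent_prod)
  hence "convergent (\<lambda>n. \<Prod>j\<le>n. 1 - a * q ^ j)"
    by (rule convergent_prod_imp_convergent)
  hence "convergent (\<lambda>n. qpoch a q (Suc n))"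
    by (simp add: qpoch_def lessThan_Suc_atMost)
  hence "convergent (\<lambda>n. qpoch a q n)"
    by (subst (asm) convergent_Suc_iff)
  thus ?thesis
    by (simp add: qpoch_inf_def convergent_LIMSEQ_iff)
qed

end

theory Submission
  imports Defs
begin

text \<open>
  Put \<open>W(z) = (\<Sum>n\<ge>1. q\<^sup>n w\<^sub>n(z))\<close> with \<open>w\<^sub>n(z) = 1 / ((zq\<^sup>n;q)\<^sub>n\<^sub>+\<^sub>1 (zq\<^sup>2\<^sup>n\<^sup>+\<^sup>2;q\<^sup>2)\<^sub>\<infinity>)\<close>; the left-hand side
  is \<open>W(-1)\<close>. Since \<open>w\<^sub>n(zq\<^sup>2)\<close> and \<open>w\<^sub>n\<^sub>+\<^sub>1(z)\<close> are rational multiples of \<open>w\<^sub>n(z)\<close>, telescoping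
  gives \<open>(1 - zq) W(z) = q + q W(zq\<^sup>2)\<close>, and iterating this yields
  \<open>W(z) = (\<Sum>k\<ge>0. q\<^sup>k\<^sup>+\<^sup>1 / (zq;q\<^sup>2)\<^sub>k\<^sub>+\<^sub>1)\<close>. For \<open>z = -1\<close> the Rogers--Fine identity turns the
  latter into \<open>\<Sum>n\<ge>0. (-1)\<^sup>n q^(2n\<^sup>2+2n+1) / (q\<^sup>2;q\<^sup>4)\<^sub>n\<^sub>+\<^sub>1\<close>, which is \<open>q\<close> times a false theta function
  of Rogers in the base \<open>q\<^sup>2\<close>. The last two identities are limiting cases of Rogers--Fine and
  are again obtained by iterating a first-order functional equation.
\<close>

section \<open>q-Pochhammer products: recurrences, uniform bounds, geometric domination\<close>

lemma qpoch_0 [simp]: "qpoch a q 0 = 1"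
  by (simp add: qpoch_def)

lemma qpoch_Suc: "qpoch a q (Suc n) = qpoch a q n * (1 - a * q ^ n)"
  by (simp add: qpoch_def)

lemma qpoch_Suc_shift: "qpoch a q (Suc n) = (1 - a) * qpoch (a * q) q n"
  unfolding qpoch_def prod.lessThan_Suc_shift by (simp add: mult.assoc)

lemma qpoch_inf_shift:
  assumes "norm q < 1"
  shows "qpoch_inf a q = (1 - a) * qpoch_inf (a * q) q"
proof (rule LIMSEQ_unique)
  show "(\<lambda>n. qpoch a q (Suc n)) \<longlonglongrightarrow> qpoch_inf a q"
    using qpoch_tendsto_qpoch_inf[OF assms] by (rule LIMSEQ_Suc)
  show "(\<lambda>n. qpoch a q (Suc n)) \<longlonglongrightarrow> (1 - a) * qpoch_inf (a * q) q"
    unfolding qpoch_Suc_shift by (intro tendsto_intros qpoch_tendsto_qpoch_inf assms)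
qed

text \<open>Each factor is dominated by an exponential, so the bound is independent of
  \<open>n\<close> and vanishes as \<open>a\<close> tends to 0. This uniformity later allows the
  number of factors to grow while the argument shrinks.\<close>

lemma norm_qpoch_minus_1_le:
  assumes "norm q < 1"
  shows "norm (qpoch a q n - 1) \<le> exp (norm a / (1 - norm q)) - 1"
proof -
  have "norm (qpoch a q n - 1) = norm ((\<Prod>j<n. 1 + - (a * q ^ j)) - 1)"
    by (simp add: qpoch_def)
  also have "\<dots> \<le> (\<Prod>j<n. 1 + norm (- (a * q ^ j))) - 1"
    by (rule norm_prod_minus1_le_prod_minus1)
  also have "(\<Prod>j<n. 1 + norm (- (a * q ^ j))) \<le> (\<Prod>j<n. exp (norm a * norm q ^ j))"
    by (intro prod_mono) (auto simp: norm_mult norm_power exp_ge_add_one_self)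
  also have "\<dots> = exp (norm a * (\<Sum>j<n. norm q ^ j))"
    by (simp add: exp_sum sum_distrib_left)
  also have "(\<Sum>j<n. norm q ^ j) \<le> (\<Sum>j. norm q ^ j)"
    using assms by (intro sum_le_suminf summable_geometric) auto
  also have "\<dots> = 1 / (1 - norm q)"
    using assms by (subst suminf_geometric) auto
  finally show ?thesis
    by (simp add: mult_left_mono)
qed

lemma norm_qpoch_inf_minus_1_le:
  assumes "norm q < 1"
  shows "norm (qpoch_inf a q - 1) \<le> exp (norm a / (1 - norm q)) - 1"
proof (rule LIMSEQ_le_const2)
  show "(\<lambda>n. norm (qpoch a q n - 1)) \<longlonglongrightarrow> norm (qpoch_inf a q - 1)"
    by (intro tendsto_intros qpoch_tendsto_qpoch_inf assms)
qed (use norm_qpoch_minus_1_le[OF assms] in auto)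

text \<open>The factor with index j has norm at least 1 - s|q|^j, and the infinite product of these
  numbers is positive for 0 \<le> s < 1. One constant has to serve the whole disc, because the
  functional equations are iterated with moving parameters \<open>a * q ^ k\<close>.\<close>

lemma qpoch_bounded_below:
  assumes "norm q < 1" "s < 1"
  obtains c where "c > 0"
    and "\<And>a n. norm a \<le> s \<Longrightarrow> c \<le> norm (qpoch a q n)"
    and "\<And>a. norm a \<le> s \<Longrightarrow> c \<le> norm (qpoch_inf a q)"
proof (cases "s < 0")
  case True
  hence "\<not> norm a \<le> s" for a :: complex
    using norm_ge_zero[of a] by linarith
  thus ?thesis using that[of 1] by auto
next
  case False
  define g where "g j = 1 - s * norm q ^ j" for j
  have s: "s \<ge> 0" using False by simp
  have le: "s * norm q ^ j \<le> s" for j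
    using assms s by (simp add: mult_left_le power_le_one)
  have g: "0 < g j" "g j \<le> 1" for j
    using le[of j] assms s by (auto simp: g_def)
  have "summable (\<lambda>j. norm (g j - 1))"
    using assms s by (auto simp: g_def intro!: summable_mult summable_geometric)
  hence "convergent_prod g"
    by (intro abs_convergent_prod_imp_convergent_prod summable_imp_abs_convergent_prod)
  then obtain L where L: "(\<lambda>n. \<Prod>j\<le>n. g j) \<longlonglongrightarrow> L" "L \<noteq> 0"
    using g by (auto simp: convergent_prod_iff_nz_lim less_imp_neq[symmetric] order_less_imp_not_eq2)
  \<comment> \<open>All factors lie in (0,1], so the partial products decrease and their limit
    \<open>L\<close> bounds every one of them from below.\<close>
  have dec: "decseq (\<lambda>n. \<Prod>j\<le>n. g j)"
    using g by (intro decseq_SucI) (auto simp: mult_left_le prod_nonneg less_imp_le)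
  have "L \<ge> 0"
    using L(1) by (rule LIMSEQ_le_const) (use g in \<open>auto intro!: prod_nonneg intro: less_imp_le\<close>)
  with L have "L > 0" by simp
  moreover have bd: "L \<le> norm (qpoch a q n)" if "norm a \<le> s" for a n
  proof -
    have "L \<le> (\<Prod>j\<le>n. g j)"
      using decseq_ge[OF dec L(1)] .
    also have "\<dots> = (\<Prod>j<n. g j) * g n"
      by (simp flip: lessThan_Suc_atMost)
    also have "\<dots> \<le> (\<Prod>j<n. g j)"
      using g by (intro mult_left_le prod_nonneg) (auto intro: less_imp_le)
    also have "\<dots> \<le> (\<Prod>j<n. norm (1 - a * q ^ j))"
    proof (intro prod_mono conjI)
      fix j
      have "norm (a * q ^ j) \<le> s * norm q ^ j"
        using that by (simp add: norm_mult norm_power mult_right_mono)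
      thus "g j \<le> norm (1 - a * q ^ j)"
        using norm_triangle_ineq2[of 1 "a * q ^ j"] by (simp add: g_def)
    qed (use g in \<open>auto intro: less_imp_le\<close>)
    finally show ?thesis
      by (simp add: qpoch_def prod_norm)
  qed
  moreover have "L \<le> norm (qpoch_inf a q)" if "norm a \<le> s" for a
    using tendsto_norm[OF qpoch_tendsto_qpoch_inf[OF assms(1)]]
    by (rule LIMSEQ_le_const) (use bd that in auto)
  ultimately show ?thesis
    using that by blast
qed

lemma qpoch_nonzero:
  assumes "norm q < 1" "norm a < 1"
  shows "qpoch a q n \<noteq> 0"
  using qpoch_bounded_below[OF assms] by (metis norm_zero not_le order_refl)

lemma geometric_bound_suminf:
  fixes u :: "nat \<Rightarrow> complex"
  assumes "0 \<le> r" "r < 1" "\<And>n. norm (u n) \<le> C * r ^ n"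
  shows "summable u" "norm (suminf u) \<le> C / (1 - r)"
proof -
  have sm: "summable (\<lambda>n. C * r ^ n)"
    using assms by (intro summable_mult summable_geometric) auto
  show "summable u"
    using sm by (rule summable_comparison_test') (use assms in auto)
  have "norm (suminf u) \<le> (\<Sum>n. C * r ^ n)"
    using sm assms(3) by (intro norm_suminf_le)
  also have "\<dots> = C / (1 - r)"
    using assms by (subst suminf_mult) (auto simp: suminf_geometric intro!: summable_geometric)
  finally show "norm (suminf u) \<le> C / (1 - r)" .
qed

lemma tendsto_zero_geometric_bound:
  fixes u :: "nat \<Rightarrow> complex"
  assumes "0 \<le> r" "r < 1" "\<And>n. norm (u n) \<le> C * r ^ n"
  shows "u \<longlonglongrightarrow> 0"
  using geometric_bound_suminf(1)[OF assms] by (rule summable_LIMSEQ_zero)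

section \<open>The Rogers--Fine identity with vanishing numerator parameter\<close>

text \<open>The exponent n(n-1) is written with truncated subtraction; the case n = 0 is harmless
  because the product is 0 anyway.\<close>

lemma mult_pred_add: "n * (n - 1) + 2 * n = Suc n * n" for n :: nat
  by (cases n) auto

lemma power_Suc_mult_pred: "(x :: 'a :: monoid_mult) ^ (Suc n * (Suc n - 1)) = x ^ (n * (n - 1)) * x ^ (2 * n)"
  by (simp only: diff_Suc_1 mult_pred_add flip: power_add)

text \<open>This is Fine's function F(a,b;t), the sum of (aq;q)_n t^n / (bq;q)_n, at a = 0 and with
  c in place of bq.\<close>

definition fine_sum :: "complex \<Rightarrow> complex \<Rightarrow> complex \<Rightarrow> complex" where
  "fine_sum q c t = (\<Sum>n. t ^ n / qpoch c q n)"

lemma norm_mult_power_le: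
  fixes a q :: "'a :: real_normed_div_algebra"
  assumes "norm q < 1" "norm a \<le> s"
  shows "norm (a * q ^ k) \<le> s"
proof -
  have "norm (a * q ^ k) = norm a * norm q ^ k" by (simp add: norm_mult norm_power)
  also have "\<dots> \<le> norm a" using assms by (simp add: mult_left_le power_le_one)
  finally show ?thesis using assms by simp
qed

lemma fine_sum_bound:
  assumes "norm q < 1" "s < 1" "r < 1"
  obtains B where "\<And>c t. norm c \<le> s \<Longrightarrow> norm t \<le> r \<Longrightarrow> summable (\<lambda>n. t ^ n / qpoch c q n)"
    and "\<And>c t. norm c \<le> s \<Longrightarrow> norm t \<le> r \<Longrightarrow> norm (fine_sum q c t) \<le> B"
proof -
  obtain d where d: "d > 0" "\<And>a n. norm a \<le> s \<Longrightarrow> d \<le> norm (qpoch a q n)"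
    using qpoch_bounded_below[OF assms(1,2)] by metis
  have *: "norm (t ^ n / qpoch c q n) \<le> 1 / d * r ^ n" if "norm c \<le> s" "norm t \<le> r" for c t n
  proof -
    have "norm (t ^ n / qpoch c q n) \<le> r ^ n / d"
      unfolding norm_divide norm_power
      using that d by (intro frac_le power_mono zero_le_power) (auto intro: order_trans[OF norm_ge_zero])
    thus ?thesis by simp
  qed
  have r: "0 \<le> r" if "norm t \<le> r" for t :: complex
    using that norm_ge_zero[of t] by linarith
  show ?thesis
  proof (rule that)
    fix c t :: complex assume ct: "norm c \<le> s" "norm t \<le> r"
    note gb = geometric_bound_suminf[OF r[OF ct(2)] assms(3) *[OF ct]]
    show "summable (\<lambda>n. t ^ n / qpoch c q n)" by (rule gb(1))
    show "norm (fine_sum q c t) \<le> 1 / d / (1 - r)" unfolding fine_sum_def by (rule gb(2))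
  qed
qed

text \<open>After multiplication by ct/(1-c), the shifted series has terms c q^n t^(n+1) /
  (c;q)_(n+1). Adding t^(n+1) / (c;q)_n to such a term leaves t^(n+1) / (c;q)_(n+1), the next term
  of the original series, so the difference of the two series telescopes.\<close>

lemma fine_sum_shift:
  assumes "norm q < 1" "norm c < 1" "norm t < 1"
  shows "(1 - t) * fine_sum q c t = 1 + c * t / (1 - c) * fine_sum q (c * q) (t * q)"
proof -
  define u where "u n = t ^ n / qpoch c q n" for n
  obtain B where B: "\<And>c' t'. norm c' \<le> norm c \<Longrightarrow> norm t' \<le> norm t \<Longrightarrow> summable (\<lambda>n. t' ^ n / qpoch c' q n)"
    using fine_sum_bound[OF assms] by metis
  have sm: "summable u" unfolding u_def by (intro B) auto
  have "norm (c * q) \<le> norm c" "norm (t * q) \<le> norm t"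
    using norm_mult_power_le[OF assms(1) order_refl, of _ 1] by auto
  hence sm': "summable (\<lambda>n. (t * q) ^ n / qpoch (c * q) q n)" by (intro B)
  have nz: "qpoch c q n \<noteq> 0" for n
    using qpoch_nonzero assms by blast
  have nz1: "1 - c \<noteq> 0" using assms by auto
  have pt: "(1 - t) * u n - c * t / (1 - c) * ((t * q) ^ n / qpoch (c * q) q n) = u n - u (Suc n)" for n
  proof -
    have e: "c * t / (1 - c) * ((t * q) ^ n / qpoch (c * q) q n) = c * q ^ n * t ^ Suc n / qpoch c q (Suc n)"
      by (simp add: qpoch_Suc_shift power_mult_distrib mult_ac)
    have "1 - c * q ^ n \<noteq> 0" using nz[of "Suc n"] by (simp add: qpoch_Suc)
    thus ?thesis
      unfolding e u_def using nz[of n] by (simp add: qpoch_Suc field_simps)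
  qed
  have "(\<lambda>n. (1 - t) * u n - c * t / (1 - c) * ((t * q) ^ n / qpoch (c * q) q n)) sums
          ((1 - t) * fine_sum q c t - c * t / (1 - c) * fine_sum q (c * q) (t * q))"
    unfolding fine_sum_def u_def[symmetric] by (intro sums_diff sums_mult summable_sums sm sm')
  moreover have "(\<lambda>n. u n - u (Suc n)) sums (u 0 - 0)"
    using sm by (intro telescope_sums' summable_LIMSEQ_zero)
  ultimately have "(1 - t) * fine_sum q c t - c * t / (1 - c) * fine_sum q (c * q) (t * q) = u 0 - 0"
    unfolding pt by (rule sums_unique2)
  thus ?thesis by (simp add: u_def algebra_simps)
qed

text \<open>Iterating \<open>fine_sum_shift\<close> moves (c,t) through (c q^n, t q^n). Each round
  contributes one summand, and the accumulated powers of q turn the linear exponent of the original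
  series into a quadratic one.\<close>

lemma rogers_fine:
  assumes "norm q < 1" "norm c < 1" "norm t < 1"
  shows "(\<lambda>n. (c * t) ^ n * q ^ (n * (n - 1)) / (qpoch c q n * qpoch t q (Suc n))) sums fine_sum q c t"
proof -
  \<comment> \<open>\<open>P n\<close> is the product of the coefficients collected in
    \<open>n\<close> rounds, and \<open>g n\<close> is the remainder still to be expanded. It tends
    to 0 because \<open>P n\<close> decays like |ct|^n while the Fine sums stay uniformly
    bounded.\<close>
  define P where "P n = (c * t) ^ n * q ^ (n * (n - 1)) / (qpoch c q n * qpoch t q n)" for n
  define g where "g n = P n * fine_sum q (c * q ^ n) (t * q ^ n)" for n
  have nz: "qpoch c q n \<noteq> 0" "qpoch t q n \<noteq> 0" for n
    using qpoch_nonzero assms by blast+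
  have nz': "1 - c * q ^ n \<noteq> 0" "1 - t * q ^ n \<noteq> 0" for n
    using nz(1)[of "Suc n"] nz(2)[of "Suc n"] by (auto simp: qpoch_Suc)
  have PS: "P (Suc n) = P n * (c * q ^ n * (t * q ^ n)) / ((1 - c * q ^ n) * (1 - t * q ^ n))" for n
    unfolding P_def power_Suc_mult_pred mult_2 power_add by (simp add: qpoch_Suc field_simps)
  have step: "P n / (1 - t * q ^ n) = g n - g (Suc n)" for n
  proof -
    have "norm (c * q ^ n) < 1" "norm (t * q ^ n) < 1"
      using norm_mult_power_le[OF assms(1) order_refl] assms by (meson le_less_trans)+
    from fine_sum_shift[OF assms(1) this]
    have sh: "fine_sum q (c * q ^ n) (t * q ^ n) =
            (1 + c * q ^ n * (t * q ^ n) / (1 - c * q ^ n) * fine_sum q (c * q ^ Suc n) (t * q ^ Suc n)) / (1 - t * q ^ n)"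
      using nz'(2)[of n] by (simp add: field_simps)
    thus ?thesis
      unfolding g_def PS sh by (simp add: distrib_left add_divide_distrib mult_ac)
  qed
  obtain B where B: "\<And>c' t'. norm c' \<le> norm c \<Longrightarrow> norm t' \<le> norm t \<Longrightarrow> norm (fine_sum q c' t') \<le> B"
    using fine_sum_bound[OF assms] by metis
  obtain d where d: "d > 0" "\<And>n. d \<le> norm (qpoch c q n)"
    using qpoch_bounded_below[OF assms(1,2)] by (metis order_refl)
  obtain e where e: "e > 0" "\<And>n. e \<le> norm (qpoch t q n)"
    using qpoch_bounded_below[OF assms(1,3)] by (metis order_refl)
  have "norm (g n) \<le> (1 / (d * e) * B) * norm (c * t) ^ n" for n
  proof -
    have "norm ((c * t) ^ n * q ^ (n * (n - 1))) \<le> norm (c * t) ^ n"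
      using norm_mult_power_le[OF assms(1) order_refl] by (metis norm_power)
    hence "norm (P n) \<le> norm (c * t) ^ n / (d * e)"
      unfolding P_def norm_divide norm_mult[of "qpoch c q n"]
      using d e by (intro frac_le mult_mono) auto
    hence "norm (g n) \<le> norm (c * t) ^ n / (d * e) * B"
      unfolding g_def norm_mult[of "P n"]
      using B norm_mult_power_le[OF assms(1) order_refl] d e by (intro mult_mono) auto
    thus ?thesis by (simp add: mult.commute)
  qed
  moreover have "norm (c * t) < 1"
    using assms mult_strict_mono'[of "norm c" 1 "norm t" 1] by (simp add: norm_mult)
  ultimately have "g \<longlonglongrightarrow> 0"
    by (rule tendsto_zero_geometric_bound[OF norm_ge_zero, rotated])
  hence "(\<lambda>n. g n - g (Suc n)) sums (g 0 - 0)"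
    by (rule telescope_sums')
  moreover have "g n - g (Suc n) = (c * t) ^ n * q ^ (n * (n - 1)) / (qpoch c q n * qpoch t q (Suc n))" for n
    unfolding step[symmetric] by (simp add: P_def qpoch_Suc)
  ultimately show ?thesis
    by (simp add: g_def P_def)
qed

section \<open>A false theta function of Rogers\<close>

text \<open>At x = q these are the terms (-1)^n q^(n^2+n) / (q;q^2)_(n+1) of Rogers' false theta
  series. The free variable x makes room for the shift from x to x q^2.\<close>

definition rogers_term :: "complex \<Rightarrow> complex \<Rightarrow> nat \<Rightarrow> complex" where
  "rogers_term q x n = (-1) ^ n * x ^ (2 * n) * q ^ (n * (n - 1)) / qpoch x (q ^ 2) (Suc n)"

lemma norm_power2_less_1: "norm q < 1 \<Longrightarrow> norm (q ^ 2) < 1" for q :: complex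
  by (simp add: norm_power power_less_one_iff)

lemma rogers_term_bound:
  assumes "norm q < 1" "s < 1"
  obtains B where "\<And>x. norm x \<le> s \<Longrightarrow> summable (rogers_term q x)"
    and "\<And>x. norm x \<le> s \<Longrightarrow> norm (suminf (rogers_term q x)) \<le> B"
proof -
  obtain d where d: "d > 0" "\<And>a n. norm a \<le> s \<Longrightarrow> d \<le> norm (qpoch a (q ^ 2) n)"
    using qpoch_bounded_below[OF norm_power2_less_1[OF assms(1)] assms(2)] by metis
  have *: "norm (rogers_term q x n) \<le> 1 / d * (s ^ 2) ^ n" if x: "norm x \<le> s" for x n
  proof -
    have "norm ((-1) ^ n * x ^ (2 * n) * q ^ (n * (n - 1))) \<le> norm ((-1) ^ n * x ^ (2 * n))"
      by (rule norm_mult_power_le[OF assms(1) order_refl])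
    also have "\<dots> = (norm x ^ 2) ^ n" by (simp add: norm_mult norm_power power_mult)
    also have "\<dots> \<le> (s ^ 2) ^ n" using x by (intro power_mono) auto
    finally have "norm (rogers_term q x n) \<le> (s ^ 2) ^ n / d"
      unfolding rogers_term_def norm_divide[of "_ * _"] using d x by (intro frac_le) auto
    thus ?thesis by simp
  qed
  have s: "0 \<le> s ^ 2" "s ^ 2 < 1" if "norm x \<le> s" for x :: complex
  proof -
    have "0 \<le> s" using that norm_ge_zero[of x] by linarith
    thus "s ^ 2 < 1" using assms by (simp add: power_less_one_iff)
  qed auto
  show ?thesis
  proof (rule that)
    fix x :: complex assume x: "norm x \<le> s"
    note gb = geometric_bound_suminf[OF s[OF x] *[OF x]]
    show "summable (rogers_term q x)" by (rule gb(1))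
    show "norm (suminf (rogers_term q x)) \<le> 1 / d / (1 - s ^ 2)" by (rule gb(2))
  qed
qed

lemma rogers_shift:
  assumes "norm q < 1" "norm x < 1"
  shows "suminf (rogers_term q x) = 1 + x - x ^ 3 * q ^ 2 * suminf (rogers_term q (x * q ^ 2))"
proof -
  let ?j = "rogers_term q x"
  obtain B where B: "\<And>y. norm y \<le> norm x \<Longrightarrow> summable (rogers_term q y)"
    using rogers_term_bound[OF assms] by metis
  have sm: "summable ?j" by (intro B) auto
  have sm': "summable (rogers_term q (x * q ^ 2))"
    by (intro B norm_mult_power_le assms(1)) auto
  have nz: "qpoch x (q ^ 2) n \<noteq> 0" for n
    using qpoch_nonzero[OF norm_power2_less_1[OF assms(1)] assms(2)] .
  have x1: "1 - x \<noteq> 0" using assms by auto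
  \<comment> \<open>Telescoping certificate: the shifted term and the next term are rational
    multiples of \<open>?j n\<close>, so the claim reduces to a rational identity.
    \<open>T 0\<close> is (1 - x^2)/(1 - x), the source of the inhomogeneous part 1 + x.\<close>
  define T where "T n = (1 - x ^ 2 * q ^ (2 * n)) * ?j n" for n
  have pt: "?j n + x ^ 3 * q ^ 2 * rogers_term q (x * q ^ 2) n = T n - T (Suc n)" for n
  proof -
    have nz1: "1 - x * q ^ (2 * Suc n) \<noteq> 0"
      using nz[of "Suc (Suc n)"] unfolding power_mult by (auto simp: qpoch_Suc)
    have jS: "?j (Suc n) = - (x ^ 2 * q ^ (2 * n)) * ?j n / (1 - x * q ^ (2 * Suc n))"
      unfolding rogers_term_def power_Suc_mult_pred qpoch_Suc[of _ _ "Suc n"]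
      by (simp add: power_mult power_mult_distrib power2_eq_square mult_ac)
    have "qpoch (x * q ^ 2) (q ^ 2) (Suc n) = qpoch x (q ^ 2) (Suc n) * (1 - x * q ^ (2 * Suc n)) / (1 - x)"
      using x1 qpoch_Suc[of x "q ^ 2" "Suc n"] qpoch_Suc_shift[of x "q ^ 2" "Suc n"]
      unfolding power_mult by (simp add: field_simps)
    hence sh: "rogers_term q (x * q ^ 2) n = ?j n * q ^ (4 * n) * (1 - x) / (1 - x * q ^ (2 * Suc n))"
      unfolding rogers_term_def power_mult_distrib
      by (simp add: mult_ac flip: power_mult)
    have e: "q ^ (4 * n) = q ^ (2 * n) * q ^ (2 * n)" "q ^ (2 * Suc n) = q ^ 2 * q ^ (2 * n)"
      by (simp_all flip: power_add)
    show ?thesis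
      unfolding T_def jS sh using nz1 unfolding e
      by (simp add: divide_simps) (simp add: algebra_simps power2_eq_square power3_eq_cube)
  qed
  have "(\<lambda>n. q ^ (2 * n) * ?j n) \<longlonglongrightarrow> 0"
    using summable_LIMSEQ_zero[OF sm]
    by (rule Lim_null_comparison[rotated, OF tendsto_norm_zero])
       (auto simp: norm_mult norm_power mult_left_le_one_le power_le_one assms less_imp_le)
  hence "(\<lambda>n. ?j n - x ^ 2 * (q ^ (2 * n) * ?j n)) \<longlonglongrightarrow> 0 - x ^ 2 * 0"
    by (intro tendsto_intros summable_LIMSEQ_zero[OF sm])
  hence "T \<longlonglongrightarrow> 0"
    by (simp add: T_def[abs_def] algebra_simps)
  hence "(\<lambda>n. T n - T (Suc n)) sums (T 0 - 0)"
    by (rule telescope_sums')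
  moreover have "(\<lambda>n. ?j n + x ^ 3 * q ^ 2 * rogers_term q (x * q ^ 2) n) sums
      (suminf ?j + x ^ 3 * q ^ 2 * suminf (rogers_term q (x * q ^ 2)))"
    by (intro sums_add sums_mult summable_sums sm sm')
  ultimately have "suminf ?j + x ^ 3 * q ^ 2 * suminf (rogers_term q (x * q ^ 2)) = T 0 - 0"
    unfolding pt by (rule sums_unique2[rotated])
  also have "T 0 = 1 + x"
    using x1 by (simp add: T_def rogers_term_def qpoch_Suc field_simps power2_eq_square)
  finally show ?thesis by (simp add: algebra_simps)
qed

lemma rogers_false_theta:
  assumes "norm q < 1" "norm x < 1"
  shows "(\<lambda>n. (-1) ^ n * x ^ (3 * n) * q ^ (3 * (n * (n - 1)) + 2 * n) * (1 + x * q ^ (2 * n)))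
           sums suminf (rogers_term q x)"
proof -
  \<comment> \<open>The product over k < n of the coefficients -(x q^(2k))^3 q^2 supplied by
    \<open>rogers_shift\<close>.\<close>
  define P where "P n = (-1) ^ n * x ^ (3 * n) * q ^ (3 * (n * (n - 1)) + 2 * n)" for n
  define g where "g n = P n * suminf (rogers_term q (x * q ^ (2 * n)))" for n
  have PS: "P (Suc n) = - P n * (x * q ^ (2 * n)) ^ 3 * q ^ 2" for n
  proof -
    have "3 * (Suc n * (Suc n - 1)) + 2 * Suc n = 3 * (n * (n - 1)) + 2 * n + 2 * n * 3 + 2"
      using mult_pred_add[of n] by simp
    hence e: "q ^ (3 * (Suc n * (Suc n - 1)) + 2 * Suc n) =
        q ^ (3 * (n * (n - 1)) + 2 * n) * (q ^ (2 * n)) ^ 3 * q ^ 2"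
      by (simp only: power_add power_mult)
    have "x ^ (3 * Suc n) = x ^ (3 * n) * x ^ 3" by (simp add: add.commute flip: power_add)
    thus ?thesis unfolding P_def e by (simp add: power_mult_distrib)
  qed
  have step: "P n * (1 + x * q ^ (2 * n)) = g n - g (Suc n)" for n
  proof -
    have "norm (x * q ^ (2 * n)) < 1"
      using norm_mult_power_le[OF assms(1) order_refl] assms by (meson le_less_trans)
    from rogers_shift[OF assms(1) this]
    have sh: "suminf (rogers_term q (x * q ^ (2 * n))) = 1 + x * q ^ (2 * n)
       - (x * q ^ (2 * n)) ^ 3 * q ^ 2 * suminf (rogers_term q (x * q ^ (2 * Suc n)))"
      by (simp add: mult_ac power2_eq_square)
    show ?thesis unfolding g_def PS sh by (simp add: algebra_simps)
  qed
  obtain B where B: "\<And>y. norm y \<le> norm x \<Longrightarrow> norm (suminf (rogers_term q y)) \<le> B"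
    using rogers_term_bound[OF assms] by metis
  have "norm (g n) \<le> B * (norm x ^ 3) ^ n" for n
  proof -
    have "norm (P n) \<le> norm ((-1) ^ n * x ^ (3 * n))"
      unfolding P_def by (rule norm_mult_power_le[OF assms(1) order_refl])
    hence "norm (P n) \<le> (norm x ^ 3) ^ n"
      by (simp add: norm_mult norm_power power_mult)
    hence "norm (g n) \<le> (norm x ^ 3) ^ n * B"
      unfolding g_def norm_mult[of "P n"]
      using B norm_mult_power_le[OF assms(1) order_refl] by (intro mult_mono) auto
    thus ?thesis by (simp add: mult.commute)
  qed
  moreover have "norm x ^ 3 < 1" using assms by (simp add: power_less_one_iff)
  ultimately have "g \<longlonglongrightarrow> 0"
    by (intro tendsto_zero_geometric_bound) auto
  hence "(\<lambda>n. g n - g (Suc n)) sums (g 0 - 0)"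
    by (rule telescope_sums')
  thus ?thesis
    unfolding step[symmetric] by (simp add: g_def P_def)
qed

section \<open>The two-variable series\<close>

text \<open>The extra variable z is what gets iterated: the shift to z q^2 leaves the point z = -1
  of interest.\<close>

definition omega_factor :: "complex \<Rightarrow> complex \<Rightarrow> nat \<Rightarrow> complex" where
  "omega_factor q z n = 1 / (qpoch (z * q ^ n) q (n + 1) * qpoch_inf (z * q ^ (2 * n + 2)) (q ^ 2))"

definition omega_sum :: "complex \<Rightarrow> complex \<Rightarrow> complex" where
  "omega_sum q z = (\<Sum>n. q ^ Suc n * omega_factor q z (Suc n))"

text \<open>Since the outer sum starts at n = 1, only arguments z q^k with k > 0 occur. They stay in
  the disc of radius |q| even for |z| = 1, so the bounds reach the boundary point z = -1.\<close>

lemma norm_mult_power_Suc_le: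
  fixes q z :: complex
  assumes "norm q < 1" "norm z \<le> 1" "0 < k"
  shows "norm (z * q ^ k) \<le> norm q"
proof -
  have "norm (z * q ^ 1 * q ^ (k - 1)) \<le> norm (z * q ^ 1)"
    by (rule norm_mult_power_le[OF assms(1) order_refl])
  also have "\<dots> \<le> norm q"
    using assms by (simp add: norm_mult mult_left_le_one_le)
  also have "z * q ^ 1 * q ^ (k - 1) = z * q ^ k"
    using assms(3) by (cases k) auto
  finally show ?thesis .
qed

lemma omega_sum_bound:
  assumes "norm q < 1"
  obtains B where "\<And>z. norm z \<le> 1 \<Longrightarrow> summable (\<lambda>n. q ^ Suc n * omega_factor q z (Suc n))"
    and "\<And>z. norm z \<le> 1 \<Longrightarrow> norm (omega_sum q z) \<le> B"
proof -
  obtain d where d: "d > 0" "\<And>a n. norm a \<le> norm q \<Longrightarrow> d \<le> norm (qpoch a q n)"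
    using qpoch_bounded_below[OF assms assms] by metis
  obtain e where e: "e > 0" "\<And>a. norm a \<le> norm q \<Longrightarrow> e \<le> norm (qpoch_inf a (q ^ 2))"
    using qpoch_bounded_below[OF norm_power2_less_1[OF assms] assms] by metis
  have *: "norm (q ^ Suc n * omega_factor q z (Suc n)) \<le> norm q / (d * e) * norm q ^ n"
    if "norm z \<le> 1" for z n
  proof -
    have "norm (omega_factor q z (Suc n)) \<le> 1 / (d * e)"
      unfolding omega_factor_def norm_divide norm_mult[of "qpoch _ _ _"] norm_one
      using d(1) e(1) by (intro frac_le mult_mono d(2) e(2) norm_mult_power_Suc_le[OF assms that]) auto
    hence "norm (q ^ Suc n * omega_factor q z (Suc n)) \<le> norm q ^ Suc n * (1 / (d * e))"
      unfolding norm_mult norm_power by (intro mult_left_mono) auto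
    thus ?thesis by simp
  qed
  show ?thesis
  proof (rule that)
    fix z :: complex assume z: "norm z \<le> 1"
    note gb = geometric_bound_suminf[OF norm_ge_zero assms *[OF z]]
    show "summable (\<lambda>n. q ^ Suc n * omega_factor q z (Suc n))" by (rule gb(1))
    show "norm (omega_sum q z) \<le> norm q / (d * e) / (1 - norm q)"
      unfolding omega_sum_def by (rule gb(2))
  qed
qed

text \<open>Supplies the boundary term at infinity for the telescoping of \<open>omega_sum\<close>.
  Both products have arguments tending to 0, so the exponential estimates force them to 1 although
  the finite one gets longer.\<close>

lemma omega_factor_tendsto_1:
  assumes "norm q < 1"
  shows "omega_factor q z \<longlonglongrightarrow> 1"
proof -
  let ?Q = "q ^ 2"
  have Q: "norm ?Q < 1" using norm_power2_less_1[OF assms] .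
  have z: "(\<lambda>n. norm (z * q ^ n)) \<longlonglongrightarrow> 0"
    using assms by (intro tendsto_norm_zero tendsto_mult_right_zero LIMSEQ_power_zero)
  have "filterlim (\<lambda>n. 2 * n + 2 :: nat) at_top sequentially"
    by (rule filterlim_at_top_mono[OF filterlim_ident]) auto
  hence z2: "(\<lambda>n. norm (z * q ^ (2 * n + 2))) \<longlonglongrightarrow> 0"
    by (rule filterlim_compose[OF z])
  have "(\<lambda>n. exp (norm (z * q ^ n) / (1 - norm q)) - 1) \<longlonglongrightarrow> exp (0 / (1 - norm q)) - 1"
    using assms by (intro tendsto_intros z) auto
  hence "(\<lambda>n. qpoch (z * q ^ n) q (n + 1) - 1) \<longlonglongrightarrow> 0"
    by (intro Lim_null_comparison[OF always_eventually[OF allI[OF norm_qpoch_minus_1_le[OF assms]]]]) simp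
  moreover have "(\<lambda>n. exp (norm (z * q ^ (2 * n + 2)) / (1 - norm ?Q)) - 1) \<longlonglongrightarrow> exp (0 / (1 - norm ?Q)) - 1"
    using Q by (intro tendsto_intros z2) auto
  hence "(\<lambda>n. qpoch_inf (z * q ^ (2 * n + 2)) ?Q - 1) \<longlonglongrightarrow> 0"
    by (intro Lim_null_comparison[OF always_eventually[OF allI[OF norm_qpoch_inf_minus_1_le[OF Q]]]]) simp
  ultimately have "(\<lambda>n. 1 / (qpoch (z * q ^ n) q (n + 1) * qpoch_inf (z * q ^ (2 * n + 2)) ?Q)) \<longlonglongrightarrow> 1 / (1 * 1)"
    unfolding LIM_zero_iff by (intro tendsto_intros) auto
  thus ?thesis
    by (simp add: omega_factor_def[abs_def])
qed

text \<open>Passing to n + 1, the finite product loses the factor with q^n and gains those with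
  q^(2n+1) and q^(2n+2); the last is exactly the one that the infinite product loses.\<close>

lemma omega_factor_Suc:
  assumes "norm q < 1" "norm z \<le> 1" "0 < n"
  shows "omega_factor q z (Suc n) * (1 - z * q ^ (2 * n + 1)) = omega_factor q z n * (1 - z * q ^ n)"
proof -
  have lt: "norm (z * q ^ k) < 1" if "0 < k" for k
    using norm_mult_power_Suc_le[OF assms(1,2) that] assms(1) by linarith
  have ne: "1 - z * q ^ k \<noteq> 0" if "0 < k" for k
    using lt[OF that] by auto
  have Q: "norm (q ^ 2) < 1" using norm_power2_less_1[OF assms(1)] .
  have 1: "qpoch (z * q ^ n) q (n + 1) = (1 - z * q ^ n) * qpoch (z * q ^ Suc n) q n"
    by (simp add: qpoch_Suc_shift mult_ac)
  have 2: "qpoch (z * q ^ Suc n) q (Suc n + 1) =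
     qpoch (z * q ^ Suc n) q n * (1 - z * q ^ (2 * n + 1)) * (1 - z * q ^ (2 * n + 2))"
    by (simp add: qpoch_Suc mult.assoc mult_2 flip: power_add power_Suc)
  have 3: "qpoch_inf (z * q ^ (2 * n + 2)) (q ^ 2) =
     (1 - z * q ^ (2 * n + 2)) * qpoch_inf (z * q ^ (2 * Suc n + 2)) (q ^ 2)"
    by (subst qpoch_inf_shift[OF Q]) (simp add: mult.assoc flip: power_add)
  show ?thesis
    unfolding omega_factor_def 1 2 3
    using ne[of n] ne[of "2 * n + 1"] ne[of "2 * n + 2"] assms(3) by (simp del: power_Suc)
qed

text \<open>Replacing z by z q^2 gives the same infinite product as replacing n by n + 1, and the
  same finite one except for its leading factor.\<close>

lemma omega_factor_mult_q2:
  assumes "norm q < 1" "norm z \<le> 1"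
  shows "omega_factor q (z * q ^ 2) n = omega_factor q z (Suc n) * (1 - z * q ^ Suc n)"
proof -
  have ne: "1 - z * q ^ Suc n \<noteq> 0"
    using norm_mult_power_Suc_le[OF assms, of "Suc n"] assms(1) by auto
  have 1: "qpoch (z * q ^ Suc n) q (Suc n + 1) = (1 - z * q ^ Suc n) * qpoch (z * q ^ 2 * q ^ n) q (n + 1)"
    unfolding Suc_eq_plus1[symmetric] qpoch_Suc_shift[of _ _ "Suc n"]
    by (simp add: mult_ac power2_eq_square)
  have 2: "z * q ^ 2 * q ^ (2 * n + 2) = z * q ^ (2 * Suc n + 2)"
    by (simp add: mult_ac power2_eq_square)
  show ?thesis
    unfolding omega_factor_def 1 2 using ne by (simp del: power_Suc)
qed

lemma omega_sum_shift:
  assumes "norm q < 1" "norm z \<le> 1"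
  shows "(1 - z * q) * omega_sum q z = q + q * omega_sum q (z * q ^ 2)"
proof -
  let ?w = "omega_factor q"
  have z2: "norm (z * q ^ 2) \<le> 1" using norm_mult_power_le assms .
  \<comment> \<open>The subtracted q makes \<open>T 1\<close> vanish and gives \<open>T\<close> the
    limit -q, so the boundary terms contribute exactly the inhomogeneous q.\<close>
  define T where "T n = (q ^ n - q) * ?w z n" for n
  have sm: "summable (\<lambda>n. q ^ Suc n * ?w y (Suc n))" if "norm y \<le> 1" for y
    using omega_sum_bound[OF assms(1)] that by metis
  have pt: "(1 - z * q) * (q ^ Suc n * ?w z (Suc n)) - q * (q ^ Suc n * ?w (z * q ^ 2) (Suc n))
        = T (Suc n) - T (Suc (Suc n))" for n
  proof -
    have *: "?w z (Suc (Suc n)) * (1 - z * q ^ (2 * Suc n + 1)) = ?w z (Suc n) * (1 - z * q ^ Suc n)"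
      using omega_factor_Suc[OF assms, of "Suc n"] by simp
    have "(1 - z * q) * (q ^ Suc n * ?w z (Suc n)) - q * (q ^ Suc n * ?w (z * q ^ 2) (Suc n))
        - (T (Suc n) - T (Suc (Suc n))) =
        q * (?w z (Suc n) * (1 - z * q ^ Suc n) - ?w z (Suc (Suc n)) * (1 - z * q ^ (2 * Suc n + 1)))"
      unfolding T_def omega_factor_mult_q2[OF assms] by (simp add: algebra_simps mult_2 mult_2_right power_add)
    thus ?thesis unfolding * by simp
  qed
  have "(\<lambda>n. T (Suc n)) \<longlonglongrightarrow> (0 - q) * 1"
    unfolding T_def using assms(1)
    by (intro tendsto_intros LIMSEQ_Suc[OF omega_factor_tendsto_1] LIMSEQ_Suc[OF LIMSEQ_power_zero])
  hence "(\<lambda>n. T (Suc n) - T (Suc (Suc n))) sums (T (Suc 0) - (0 - q) * 1)"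
    by (rule telescope_sums')
  moreover have "(\<lambda>n. (1 - z * q) * (q ^ Suc n * ?w z (Suc n)) - q * (q ^ Suc n * ?w (z * q ^ 2) (Suc n)))
      sums ((1 - z * q) * omega_sum q z - q * omega_sum q (z * q ^ 2))"
    unfolding omega_sum_def
    by (intro sums_diff sums_mult summable_sums sm assms(2) z2)
  ultimately have "(1 - z * q) * omega_sum q z - q * omega_sum q (z * q ^ 2) = T (Suc 0) - (0 - q) * 1"
    unfolding pt by (rule sums_unique2[rotated])
  thus ?thesis by (simp add: T_def algebra_simps)
qed

text \<open>Solving \<open>omega_sum_shift\<close> for the unshifted sum and iterating yields one
  summand per round; the remainder decays like |q|^n.\<close>

lemma omega_sum_sums:
  assumes "norm q < 1" "norm z \<le> 1"
  shows "(\<lambda>n. q ^ Suc n / qpoch (z * q) (q ^ 2) (Suc n)) sums omega_sum q z"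
proof -
  define P where "P n = q ^ n / qpoch (z * q) (q ^ 2) n" for n
  define g where "g n = P n * omega_sum q (z * q ^ (2 * n))" for n
  have zn: "norm (z * q ^ (2 * n)) \<le> 1" for n
    using norm_mult_power_le assms .
  have step: "P (Suc n) = g n - g (Suc n)" for n
  proof -
    have sh: "(1 - z * q * q ^ (2 * n)) * omega_sum q (z * q ^ (2 * n)) = q + q * omega_sum q (z * q ^ (2 * Suc n))"
      using omega_sum_shift[OF assms(1) zn[of n]] by (simp add: mult_ac power2_eq_square)
    have ne: "1 - z * q * q ^ (2 * n) \<noteq> 0"
      using norm_mult_power_Suc_le[OF assms, of "Suc (2 * n)"] assms(1) by (auto simp: mult.assoc)
    have W: "omega_sum q (z * q ^ (2 * n)) = (q + q * omega_sum q (z * q ^ (2 * Suc n))) / (1 - z * q * q ^ (2 * n))"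
      using sh ne by (simp add: field_simps)
    have PS: "P (Suc n) = P n * q / (1 - z * q * q ^ (2 * n))"
      by (simp add: P_def qpoch_Suc power_mult)
    show ?thesis
      unfolding g_def PS W by (simp add: distrib_left add_divide_distrib mult_ac)
  qed
  obtain B where B: "\<And>z. norm z \<le> 1 \<Longrightarrow> norm (omega_sum q z) \<le> B"
    using omega_sum_bound[OF assms(1)] by metis
  obtain d where d: "d > 0" "\<And>a n. norm a \<le> norm q \<Longrightarrow> d \<le> norm (qpoch a (q ^ 2) n)"
    using qpoch_bounded_below[OF norm_power2_less_1[OF assms(1)] assms(1)] by metis
  have "norm (z * q) \<le> norm q" using norm_mult_power_Suc_le[OF assms, of 1] by simp
  note d' = d(2)[OF this]
  have "norm (g n) \<le> (1 / d * B) * norm q ^ n" for n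
  proof -
    have "norm (P n) \<le> norm q ^ n / d"
      unfolding P_def norm_divide norm_power using d(1) d' by (intro frac_le) auto
    hence "norm (g n) \<le> norm q ^ n / d * B"
      unfolding g_def norm_mult[of "P n"] using B zn d by (intro mult_mono) auto
    thus ?thesis by (simp add: mult.commute)
  qed
  hence "g \<longlonglongrightarrow> 0"
    using assms(1) by (rule tendsto_zero_geometric_bound[OF norm_ge_zero, rotated])
  hence "(\<lambda>n. g n - g (Suc n)) sums (g 0 - 0)"
    by (rule telescope_sums')
  thus ?thesis
    unfolding step[symmetric] by (simp add: g_def P_def del: power_Suc)
qed

section \<open>Specialisation to z = -1\<close>

lemma qpoch_mult_qpoch_minus: "qpoch a q n * qpoch (- a) q n = qpoch (a ^ 2) (q ^ 2) n"
  unfolding qpoch_def prod.distrib[symmetric]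
  by (intro prod.cong refl) (simp add: algebra_simps power2_eq_square power_mult_distrib)

lemma omega_sum_minus_1:
  assumes "norm q < 1"
  shows "(\<lambda>j. (-1) ^ j * q ^ (6 * j ^ 2 + 4 * j + 1) * (1 + q ^ (4 * j + 2))) sums omega_sum q (-1)"
proof -
  have Q: "norm (q ^ 2) < 1" using norm_power2_less_1[OF assms] .
  have q3: "norm (- (q ^ 3)) < 1" using assms by (simp add: norm_power power_less_one_iff)
  have "(\<lambda>n. q ^ Suc n / qpoch (- q) (q ^ 2) (Suc n)) sums omega_sum q (-1)"
    using omega_sum_sums[OF assms, of "-1"] by simp
  \<comment> \<open>Splitting off the first factor 1 + q exposes Fine's function in base q^2 with c
    = -q^3 and t = q.\<close>
  also have "(\<lambda>n. q ^ Suc n / qpoch (- q) (q ^ 2) (Suc n)) =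
      (\<lambda>n. q / (1 + q) * (q ^ n / qpoch (- (q ^ 3)) (q ^ 2) n))"
    by (simp add: qpoch_Suc_shift power2_eq_square power3_eq_cube fun_eq_iff mult.assoc)
  finally have "omega_sum q (-1) = suminf (\<lambda>n. q / (1 + q) * (q ^ n / qpoch (- (q ^ 3)) (q ^ 2) n))"
    by (rule sums_unique)
  also have "\<dots> = q / (1 + q) * fine_sum (q ^ 2) (- (q ^ 3)) q"
    unfolding fine_sum_def by (intro suminf_mult, rule fine_sum_bound[OF Q q3 assms]) blast
  also have "\<dots> = q * suminf (rogers_term (q ^ 2) (q ^ 2))"
  proof -
    have "(\<lambda>n. q / (1 + q) * ((- (q ^ 3) * q) ^ n * (q ^ 2) ^ (n * (n - 1)) /
        (qpoch (- (q ^ 3)) (q ^ 2) n * qpoch q (q ^ 2) (Suc n)))) sums (q / (1 + q) * fine_sum (q ^ 2) (- (q ^ 3)) q)"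
      by (intro sums_mult rogers_fine Q q3 assms)
    also have "(\<lambda>n. q / (1 + q) * ((- (q ^ 3) * q) ^ n * (q ^ 2) ^ (n * (n - 1)) /
        (qpoch (- (q ^ 3)) (q ^ 2) n * qpoch q (q ^ 2) (Suc n)))) = (\<lambda>n. q * rogers_term (q ^ 2) (q ^ 2) n)"
    proof
      fix n
      \<comment> \<open>The prefactor 1/(1+q) completes the first product to (-q;q^2)_(n+1), which
        pairs with (q;q^2)_(n+1) to give (q^2;q^4)_(n+1), the denominator in Rogers' series.\<close>
      have "(1 + q) * qpoch (- (q ^ 3)) (q ^ 2) n = qpoch (- q) (q ^ 2) (Suc n)"
        by (simp add: qpoch_Suc_shift power2_eq_square power3_eq_cube mult.assoc)
      hence e: "(1 + q) * (qpoch (- (q ^ 3)) (q ^ 2) n * qpoch q (q ^ 2) (Suc n)) = qpoch (q ^ 2) ((q ^ 2) ^ 2) (Suc n)"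
        by (metis qpoch_mult_qpoch_minus mult.assoc mult.commute)
      have "(- (q ^ 3) * q) ^ n = (-1) ^ n * (q ^ 2) ^ (2 * n)"
        by (subst power_mult, subst power_mult_distrib[symmetric]) (simp flip: power_mult power_Suc2)
      thus "q / (1 + q) * ((- (q ^ 3) * q) ^ n * (q ^ 2) ^ (n * (n - 1)) /
        (qpoch (- (q ^ 3)) (q ^ 2) n * qpoch q (q ^ 2) (Suc n))) = q * rogers_term (q ^ 2) (q ^ 2) n"
        unfolding rogers_term_def e[symmetric] by (simp add: mult_ac)
    qed
    finally have "q / (1 + q) * fine_sum (q ^ 2) (- (q ^ 3)) q = (\<Sum>n. q * rogers_term (q ^ 2) (q ^ 2) n)"
      by (rule sums_unique)
    also have "\<dots> = q * suminf (rogers_term (q ^ 2) (q ^ 2))"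
      by (intro suminf_mult, rule rogers_term_bound[OF Q Q]) blast
    finally show ?thesis .
  qed
  finally have W: "omega_sum q (-1) = q * suminf (rogers_term (q ^ 2) (q ^ 2))" .
  \<comment> \<open>The false theta expansion is used with both the base and x equal to q^2; it
    remains to collect the exponents of q.\<close>
  have t: "q * ((-1) ^ n * (q ^ 2) ^ (3 * n) * (q ^ 2) ^ (3 * (n * (n - 1)) + 2 * n) * (1 + q ^ 2 * (q ^ 2) ^ (2 * n)))
      = (-1) ^ n * q ^ (6 * n ^ 2 + 4 * n + 1) * (1 + q ^ (4 * n + 2))" for n
  proof -
    have "6 * n ^ 2 + 4 * n + 1 = 1 + 2 * (3 * n) + 2 * (3 * (n * (n - 1)) + 2 * n)"
      using mult_pred_add[of n] by (simp add: power2_eq_square)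
    hence "q ^ (6 * n ^ 2 + 4 * n + 1) = q * (q ^ 2) ^ (3 * n) * (q ^ 2) ^ (3 * (n * (n - 1)) + 2 * n)"
      by (simp only: power_add power_mult power_one_right)
    moreover have "q ^ (4 * n + 2) = q ^ 2 * (q ^ 2) ^ (2 * n)"
      by (simp add: power_add flip: power_mult) (simp add: power2_eq_square)
    ultimately show ?thesis by (simp only: mult_ac)
  qed
  show ?thesis
    unfolding W using sums_mult[OF rogers_false_theta[OF Q Q], of q] unfolding t .
qed

theorem theorem5p1:
  fixes q :: complex
  assumes "norm q < 1"
  shows "summable (\<lambda>n. q ^ Suc n /
             (qpoch (- (q ^ Suc n)) q (Suc n + 1) * qpoch_inf (- (q ^ (2 * Suc n + 2))) (q ^ 2)))
       \<and> summable (\<lambda>j. (-1) ^ j * q ^ (6 * j ^ 2 + 4 * j + 1) * (1 + q ^ (4 * j + 2)))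
       \<and> (\<Sum>n. q ^ Suc n /
             (qpoch (- (q ^ Suc n)) q (Suc n + 1) * qpoch_inf (- (q ^ (2 * Suc n + 2))) (q ^ 2)))
         = (\<Sum>j. (-1) ^ j * q ^ (6 * j ^ 2 + 4 * j + 1) * (1 + q ^ (4 * j + 2)))"
proof -
  have e: "q ^ Suc n / (qpoch (- (q ^ Suc n)) q (Suc n + 1) * qpoch_inf (- (q ^ (2 * Suc n + 2))) (q ^ 2))
      = q ^ Suc n * omega_factor q (-1) (Suc n)" for n
    by (simp add: omega_factor_def)
  have "summable (\<lambda>n. q ^ Suc n * omega_factor q (-1) (Suc n))"
    using omega_sum_bound[OF assms] by (metis norm_minus_cancel norm_one order_refl)
  thus ?thesis
    unfolding e using omega_sum_minus_1[OF assms]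
    by (auto simp only: sums_iff omega_sum_def)
qed

end
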